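(* Let $q\ge 3$, let $n,d$ be integers with $1\le d\le n$, and put $t=n-d+1$ and $r=\left\lfloor \min\left\{\frac{n-t}{2},\frac{t-1}{q-2}\right\}\right\rfloor$. Then $$A_q(n,d)\le \frac{q^{t+2r}}{\sum_{i=0}^{r}\binom{t+2r}{i}(q-1)^i}.$$
   Context: $A_q(n,d)$ denotes the maximum number of codewords in a $q$-ary code of length $n$ (a subset of $\Sigma^n$, with $\Sigma=\{0,1,\dots,q-1\}$) in which any two distinct codewords have Hamming distance at least $d$. The Hamming distance of two sequences is the number of positions in which they differ. *)

theory Defs
  imports Complex_Main
begin

definition words :: "nat \<Rightarrow> nat \<Rightarrow> nat list set" where
  "words q n = {w. length w = n \<and> set w \<subseteq> {0..<q}}"

(* Only meaningful for sequences of equal length; it is applied only to elements of words q n. *)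
definition hamming_dist :: "'a list \<Rightarrow> 'a list \<Rightarrow> nat" where
  "hamming_dist x y = card {i. i < length x \<and> x ! i \<noteq> y ! i}"

definition is_code :: "nat \<Rightarrow> nat \<Rightarrow> nat \<Rightarrow> nat list set \<Rightarrow> bool" where
  "is_code q n d C \<longleftrightarrow>
     C \<subseteq> words q n \<and> (\<forall>x\<in>C. \<forall>y\<in>C. x \<noteq> y \<longrightarrow> d \<le> hamming_dist x y)"

definition max_code_size :: "nat \<Rightarrow> nat \<Rightarrow> nat \<Rightarrow> nat" where
  "max_code_size q n d = Max {card C | C. is_code q n d C}"

lemma finite_words: "finite (words q n)"
proof -
  have "words q n = {w. set w \<subseteq> {0..<q} \<and> length w = n}"
    by (auto simp: words_def)
  then show ?thesis
    by (simp add: finite_lists_length_eq)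
qed

(* The set under Max is finite and nonempty, so the maximum is attained. *)
lemma finite_code_sizes: "finite {card C | C. is_code q n d C}"
proof (rule finite_subset)
  show "{card C | C. is_code q n d C} \<subseteq> card ` Pow (words q n)"
    by (auto simp: is_code_def)
qed (simp add: finite_words)

lemma code_sizes_nonempty: "{card C | C. is_code q n d C} \<noteq> {}"
proof -
  have "is_code q n d {}"
    by (simp add: is_code_def)
  then show ?thesis
    by blast
qed

end

theory Submission
  imports Defs
begin

text \<open>
  Truncating the words of a code of length \<open>n\<close> and minimum distance \<open>d\<close> to their first
  \<open>t + 2 r \<le> n\<close> letters lowers distances by at most \<open>n - t - 2 r\<close>, so with \<open>t = n - d + 1\<close> the
  minimum distance is still at least \<open>2 r + 1\<close>. The balls of radius \<open>r\<close> around the truncated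
  words are therefore disjoint, and counting words gives the sphere-packing bound in
  length \<open>t + 2 r\<close>.
\<close>

lemma hamming_dist_Nil [simp]: "hamming_dist [] y = 0"
  by (simp add: hamming_dist_def)

text \<open>Splitting off position \<open>0\<close> gives a recursion on the words, which lets
  spheres be counted by induction on the length.\<close>

lemma hamming_dist_Cons [simp]:
  "hamming_dist (a # x) (b # y) = (if a = b then 0 else 1) + hamming_dist x y"
proof -
  let ?D = "{i. i < length x \<and> x ! i \<noteq> y ! i}"
  have "{i. i < length (a # x) \<and> (a # x) ! i \<noteq> (b # y) ! i} =
      (if a = b then {} else {0}) \<union> Suc ` ?D"
    (is "?L = ?R")
  proof (rule set_eqI)
    show "i \<in> ?L \<longleftrightarrow> i \<in> ?R" for i
      by (cases i) auto
  qed
  moreover have "finite ?D"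
    by simp
  ultimately show ?thesis
    by (auto simp: hamming_dist_def card_image)
qed

lemma hamming_dist_triangle:
  assumes "length x = length y" and "length y = length z"
  shows "hamming_dist x z \<le> hamming_dist x y + hamming_dist y z"
proof -
  have "card {i. i < length x \<and> x ! i \<noteq> z ! i} \<le>
      card ({i. i < length x \<and> x ! i \<noteq> y ! i} \<union> {i. i < length y \<and> y ! i \<noteq> z ! i})"
    using assms by (intro card_mono) auto
  then show ?thesis
    unfolding hamming_dist_def by (meson card_Un_le order_trans)
qed

lemma hamming_dist_commute: "length x = length y \<Longrightarrow> hamming_dist x y = hamming_dist y x"
  unfolding hamming_dist_def by metis

text \<open>A position where \<open>x\<close> and \<open>y\<close> differ either lies below
  \<open>m\<close> and survives truncation, or is one of the \<open>length x - m\<close> positions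
  cut off.\<close>

lemma hamming_dist_take:
  "hamming_dist x y \<le> hamming_dist (take m x) (take m y) + (length x - m)"
proof -
  have "card {i. i < length x \<and> x ! i \<noteq> y ! i} \<le>
      card ({i. i < length (take m x) \<and> take m x ! i \<noteq> take m y ! i} \<union> {m..<length x})"
    by (intro card_mono) auto
  also have "\<dots> \<le> hamming_dist (take m x) (take m y) + card {m..<length x}"
    unfolding hamming_dist_def by (rule card_Un_le)
  finally show ?thesis
    by (simp add: hamming_dist_def)
qed

lemma card_words: "card (words q n) = q ^ n"
proof -
  have "words q n = {w. set w \<subseteq> {0..<q} \<and> length w = n}"
    by (auto simp: words_def)
  then show ?thesis
    by (simp add: card_lists_length_eq)
qed

lemma words_0: "words q 0 = {[]}"
  by (auto simp: words_def)

lemma words_Suc: "words q (Suc n) = (\<Union>b<q. (#) b ` words q n)"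
  by (auto simp: words_def length_Suc_conv)

text \<open>Induction on the length by the first letter. A word at distance \<open>Suc j\<close>
  either keeps the letter \<open>a\<close> and has its tail at distance \<open>Suc j\<close>, or
  changes \<open>a\<close> in one of \<open>q - 1\<close> ways and has its tail at distance
  \<open>j\<close>. Pascal's rule adds the two counts.\<close>

lemma card_sphere:
  assumes "x \<in> words q n"
  shows "card {y \<in> words q n. hamming_dist x y = i} = (n choose i) * (q - 1) ^ i"
  using assms
proof (induction n arbitrary: x i)
  case 0
  then show ?case
    by (cases i) (auto simp: words_0)
next
  case (Suc n)
  from Suc.prems obtain a x' where x: "x = a # x'" "a < q" "x' \<in> words q n"
    by (auto simp: words_Suc)
  let ?S = "\<lambda>j. {y \<in> words q n. hamming_dist x' y = j}"
  have fin: "finite (?S j)" for j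
    by (simp add: finite_words)
  show ?case
  proof (cases i)
    case 0
    have "{y \<in> words q (Suc n). hamming_dist x y = i} = (#) a ` ?S 0"
      using x 0 by (auto simp: words_Suc split: if_splits)
    then show ?thesis
      using Suc.IH[OF x(3), of 0] 0 by (simp add: card_image)
  next
    case (Suc j)
    have "{y \<in> words q (Suc n). hamming_dist x y = i} =
        (#) a ` ?S (Suc j) \<union> (\<Union>b\<in>{..<q} - {a}. (#) b ` ?S j)"
      using x Suc by (auto simp: words_Suc split: if_splits)
    moreover have "card ((#) a ` ?S (Suc j) \<union> (\<Union>b\<in>{..<q} - {a}. (#) b ` ?S j)) =
        card ((#) a ` ?S (Suc j)) + card (\<Union>b\<in>{..<q} - {a}. (#) b ` ?S j)"
      using fin by (intro card_Un_disjoint) auto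
    moreover have "card (\<Union>b\<in>{..<q} - {a}. (#) b ` ?S j) =
        (\<Sum>b\<in>{..<q} - {a}. card ((#) b ` ?S j))"
      using fin by (intro card_UN_disjoint) auto
    ultimately show ?thesis
      using Suc.IH[OF x(3)] x(2) Suc by (simp add: card_image algebra_simps)
  qed
qed

lemma card_ball:
  assumes "x \<in> words q n"
  shows "card {y \<in> words q n. hamming_dist x y \<le> r} = (\<Sum>i=0..r. (n choose i) * (q - 1) ^ i)"
proof -
  have "{y \<in> words q n. hamming_dist x y \<le> r} =
      (\<Union>i\<in>{0..r}. {y \<in> words q n. hamming_dist x y = i})"
    by auto
  also have "card \<dots> = (\<Sum>i=0..r. card {y \<in> words q n. hamming_dist x y = i})"
    by (rule card_UN_disjoint) (auto simp: finite_words)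
  finally show ?thesis
    using assms by (simp add: card_sphere)
qed

text \<open>By the triangle inequality, a common point of two balls would put their centres at
  distance at most \<open>2 * r\<close>. All the balls have the same size and together fit into
  \<open>words q n\<close>.\<close>

lemma sphere_packing_bound:
  assumes "is_code q n (2 * r + 1) C"
  shows "card C * (\<Sum>i=0..r. (n choose i) * (q - 1) ^ i) \<le> q ^ n"
proof -
  let ?B = "\<lambda>x. {y \<in> words q n. hamming_dist x y \<le> r}"
  have C: "C \<subseteq> words q n"
    and dist: "\<And>x y. x \<in> C \<Longrightarrow> y \<in> C \<Longrightarrow> x \<noteq> y \<Longrightarrow> 2 * r + 1 \<le> hamming_dist x y"
    using assms by (auto simp: is_code_def)
  have "?B x \<inter> ?B y = {}" if "x \<in> C" "y \<in> C" "x \<noteq> y" for x y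
  proof (rule ccontr)
    assume "?B x \<inter> ?B y \<noteq> {}"
    then obtain z where z: "z \<in> words q n" "hamming_dist x z \<le> r" "hamming_dist y z \<le> r"
      by auto
    have "length x = length z" "length z = length y"
      using z that C by (auto simp: words_def)
    then have "hamming_dist x y \<le> 2 * r"
      using hamming_dist_triangle[of x z y] hamming_dist_commute[of z y] z by simp
    then show False
      using dist[OF that] by simp
  qed
  then have "(\<Sum>x\<in>C. card (?B x)) = card (\<Union>x\<in>C. ?B x)"
    using C finite_words by (intro card_UN_disjoint[symmetric]) (auto intro: finite_subset)
  also have "\<dots> \<le> card (words q n)"
    by (intro card_mono finite_words) auto
  also have "(\<Sum>x\<in>C. card (?B x)) = (\<Sum>x\<in>C. \<Sum>i=0..r. (n choose i) * (q - 1) ^ i)"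
    using C by (intro sum.cong refl card_ball) auto
  finally show ?thesis
    by (simp add: card_words)
qed

text \<open>The condition \<open>n - m < d\<close> keeps the subtraction \<open>d - (n - m)\<close>
  positive, so distinct codewords cannot be truncated to the same word and the code keeps its
  size.\<close>

lemma is_code_truncate:
  assumes "is_code q n d C" and "m \<le> n" and "n - m < d"
  shows "is_code q m (d - (n - m)) (take m ` C)" and "inj_on (take m) C"
proof -
  have C: "x \<in> words q n" if "x \<in> C" for x
    using that assms(1) by (auto simp: is_code_def)
  have dist: "d - (n - m) \<le> hamming_dist (take m x) (take m y)"
    if "x \<in> C" "y \<in> C" "x \<noteq> y" for x y
  proof -
    have "d \<le> hamming_dist x y"
      using that assms(1) by (auto simp: is_code_def)
    then show ?thesis
      using hamming_dist_take[of x y m] C[OF that(1)] by (simp add: words_def)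
  qed
  have "take m x \<in> words q m" if "x \<in> C" for x
    using C[OF that] assms(2) set_take_subset[of m x] by (auto simp: words_def)
  then have "take m ` C \<subseteq> words q m"
    by blast
  moreover have "d - (n - m) \<le> hamming_dist u v"
    if "u \<in> take m ` C" "v \<in> take m ` C" "u \<noteq> v" for u v
    using that dist by blast
  ultimately show "is_code q m (d - (n - m)) (take m ` C)"
    unfolding is_code_def by blast
  show "inj_on (take m) C"
  proof (rule inj_onI, rule ccontr)
    fix x y assume "x \<in> C" "y \<in> C" "take m x = take m y" "x \<noteq> y"
    then show False
      using dist[of x y] assms(3) by (simp add: hamming_dist_def)
  qed
qed

theorem lemma6:
  fixes q n d t r :: nat
  assumes "3 \<le> q" and "1 \<le> d" and "d \<le> n"
    and "t = n - d + 1"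
    and "r = nat \<lfloor>min ((real n - real t) / 2) ((real t - 1) / (real q - 2))\<rfloor>"
  shows "real (max_code_size q n d)
       \<le> real q ^ (t + 2 * r) / (\<Sum>i=0..r. real ((t + 2 * r) choose i) * (real q - 1) ^ i)"
proof -
  let ?m = "t + 2 * r"
  let ?V = "\<Sum>i=0..r. (?m choose i) * (q - 1) ^ i"
  have "t \<le> n"
    using assms by simp
  \<comment> \<open>The first argument of the minimum ensures that length \<open>t + 2 * r\<close>
    does not exceed \<open>n\<close>.\<close>
  have "r \<le> nat \<lfloor>(real n - real t) / 2\<rfloor>"
    unfolding assms(5) by (intro nat_mono floor_mono min.cobounded1)
  \<comment> \<open>Since \<open>t \<le> n\<close>, the floor is nonnegative and \<open>nat\<close>
    does not clip it.\<close>
  then have "real r \<le> (real n - real t) / 2"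
    using \<open>t \<le> n\<close> by (simp add: le_nat_iff le_floor_iff)
  then have "real ?m \<le> real n"
    by (simp add: field_simps)
  then have "?m \<le> n"
    by (simp only: of_nat_le_iff)
  have "max_code_size q n d \<in> {card C | C. is_code q n d C}"
    unfolding max_code_size_def by (intro Max_in finite_code_sizes code_sizes_nonempty)
  then obtain C where C: "is_code q n d C" "max_code_size q n d = card C"
    by auto
  \<comment> \<open>From \<open>n - t = d - 1\<close>, the number of deleted letters is
    \<open>n - ?m = d - 1 - 2 * r\<close>.\<close>
  have "d - (n - ?m) = 2 * r + 1" "n - ?m < d"
    using assms(2-4) \<open>?m \<le> n\<close> by simp_all
  then have "card C * ?V \<le> q ^ ?m"
    using is_code_truncate[OF C(1) \<open>?m \<le> n\<close>] sphere_packing_bound[of q ?m r "take ?m ` C"]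
    by (simp add: card_image)
  then have "real (card C * ?V) \<le> real (q ^ ?m)"
    by (rule of_nat_mono)
  moreover have "real ?V = (\<Sum>i=0..r. real (?m choose i) * (real q - 1) ^ i)"
    using assms(1) by (simp add: of_nat_diff)
  \<comment> \<open>The term for \<open>i = 0\<close> is already \<open>1\<close>.\<close>
  moreover have "0 < ?V"
    by (simp add: sum.atLeast_Suc_atMost)
  then have "0 < real ?V"
    by (simp only: of_nat_0_less_iff)
  ultimately show ?thesis
    using C(2) by (simp add: pos_le_divide_eq)
qed

end
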